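(* Let $X$ be a non-negative random variable, let $F(x)=P(X\le x)$ be its probability distribution function, let $\varphi(s)=\int_0^\infty e^{-sx}\,dF(x)$, $s=\sigma+i\tau\in\mathbb{C}$, be the Laplace-Stieltjes transform of $F$, and let $\sigma_0$ be the abscissa of convergence of $\varphi(s)$. Assume $-\infty<\sigma_0<0$. If $s=\sigma_0$ is a pole of $\varphi(s)$, then $$\lim_{x\to\infty}\frac{1}{x}\log P(X>x)=\sigma_0 .$$
   Context: $\varphi(s)$ equals $E[e^{-sX}]$ wherever it converges (a possible atom of $X$ at $0$ is included in the integral). The abscissa of convergence $\sigma_0$ is the number such that the integral converges for $\Re s>\sigma_0$ and diverges for $\Re s<\sigma_0$; $\varphi$ is analytic in $\Re s>\sigma_0$. Saying that $s=\sigma_0$ is a pole of $\varphi$ means that $\varphi$ extends from $\Re s>\sigma_0$ to a meromorphic function in a neighborhood of $\sigma_0$ having a pole (of some order $\ge 1$) at $\sigma_0$. *)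

theory Defs
  imports "HOL-Probability.Probability" "HOL-Complex_Analysis.Complex_Analysis"
begin

(* The integral of exp (- s x) dF(x) over [0, R]. The interval is closed at 0, so a jump of F
   at 0 is counted. *)
definition ls_partial :: "(real \<Rightarrow> real) \<Rightarrow> complex \<Rightarrow> real \<Rightarrow> complex" where
  "ls_partial F s R = (LINT x:{0..R}|interval_measure F. exp (- s * complex_of_real x))"

(* Convergence is that of the improper integral (R tending to infinity), absolute or not. *)
definition ls_converges :: "(real \<Rightarrow> real) \<Rightarrow> complex \<Rightarrow> bool" where
  "ls_converges F s \<longleftrightarrow> (\<exists>l. (ls_partial F s \<longlongrightarrow> l) at_top)"

(* Only meaningful at points s with ls_converges F s. *)
definition laplace_stieltjes :: "(real \<Rightarrow> real) \<Rightarrow> complex \<Rightarrow> complex" where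
  "laplace_stieltjes F s = Lim at_top (ls_partial F s)"

(* The abscissa is a real number here, so the predicate excludes the values -\<infinity> and \<infinity>. *)
definition is_abscissa_of_convergence :: "(real \<Rightarrow> real) \<Rightarrow> real \<Rightarrow> bool" where
  "is_abscissa_of_convergence F \<sigma>\<^sub>0 \<longleftrightarrow>
     (\<forall>s. Re s > \<sigma>\<^sub>0 \<longrightarrow> ls_converges F s) \<and>
     (\<forall>s. Re s < \<sigma>\<^sub>0 \<longrightarrow> \<not> ls_converges F s)"

(* The function f, given on the half-plane Re s > \<sigma>\<^sub>0, has a pole at the boundary point \<sigma>\<^sub>0:
   it continues to a function g meromorphic near \<sigma>\<^sub>0 with a pole there. Values of f outside
   the half-plane are irrelevant. *)
definition has_pole_at_abscissa :: "(complex \<Rightarrow> complex) \<Rightarrow> real \<Rightarrow> bool" where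
  "has_pole_at_abscissa f \<sigma>\<^sub>0 \<longleftrightarrow>
     (\<exists>U g. open U \<and> complex_of_real \<sigma>\<^sub>0 \<in> U \<and> g meromorphic_on U \<and>
        (\<forall>s\<in>U. Re s > \<sigma>\<^sub>0 \<longrightarrow> g s = f s) \<and>
        is_pole g (complex_of_real \<sigma>\<^sub>0))"

end

theory Submission
  imports Defs "HOL-Real_Asymp.Real_Asymp"
begin

text \<open>Write \<open>\<sigma>\<close> for the abscissa of convergence and \<open>D\<close> for the law of \<open>X\<close>. The upper bound for
  the tail is Markov's inequality for \<open>exp (- u X)\<close> with \<open>u\<close> slightly to the right of \<open>\<sigma>\<close>
  (lemma \<open>tail_upper_bound\<close>).

  The lower bound must exclude that the tail is, for arbitrarily large \<open>x\<close>, smaller than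
  \<open>e\<^bsup>\<sigma> x\<^esup>\<close> by an exponential factor. Since the tail decreases, such an \<open>x\<close> would create a gap: the tilted
  measure \<open>N(dy) = e\<^bsup>- \<sigma> y\<^esup> D(dy)\<close> would have almost no mass in \<open>(x, K x]\<close> for some \<open>K > 1\<close> that does
  not depend on \<open>x\<close>. A pole forbids such gaps. If its order is \<open>n\<close>, then
  \<open>\<delta>\<^sup>n \<integral> e\<^bsup>- \<delta> y\<^esup> N(dy)\<close> has a positive limit as \<open>\<delta>\<close> decreases to \<open>0\<close> along the reals
  (lemma \<open>pole_at_abscissa_power_law\<close>). By Karamata's argument this forces the rescaled
  measures \<open>x\<^sup>-\<^sup>n N(x dt)\<close> to converge weakly, after damping by \<open>e\<^sup>-\<^sup>t\<close>, to a multiple of the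
  Erlang law, whose density is proportional to \<open>t\<^bsup>n - 1\<^esup> e\<^sup>-\<^sup>t\<close> (theorem \<open>rescaled_integral_tendsto\<close>).
  The limit charges every interval \<open>(1, K)\<close>, hence \<open>N (x, K x]\<close> is eventually at least
  \<open>d x\<^sup>n\<close> with \<open>d > 0\<close> (corollary \<open>measure_Ioc_lower_bound\<close>). As the tilt is at most
  \<open>e\<^bsup>- \<sigma> K x\<^esup>\<close> on this interval, \<open>P(X > x) \<ge> d x\<^sup>n e\<^bsup>\<sigma> K x\<^esup>\<close>, and \<open>K\<close> may be taken as close to \<open>1\<close>
  as desired (lemma \<open>tail_lower_bound\<close>).\<close>

section \<open>Power-law growth of the transform at a pole\<close>

text \<open>Near a pole \<open>z\<close> of order \<open>n\<close> the continuation is \<open>h w / (w - z)\<^sup>n\<close> with \<open>h\<close> holomorphic and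
  \<open>h z \<noteq> 0\<close>. Approaching \<open>z\<close> along the real axis from the right stays in the half-plane where
  the continuation agrees with \<open>f\<close>. Taking norms makes the limit \<open>norm (h z)\<close> visibly
  positive; for a Laplace transform the norm is harmless, because the values there are
  nonnegative reals.\<close>

lemma pole_at_abscissa_power_law:
  assumes "has_pole_at_abscissa f \<sigma>"
  obtains m :: nat and c :: real where "c > 0"
    "((\<lambda>\<delta>. \<delta> ^ Suc m * norm (f (complex_of_real (\<sigma> + \<delta>)))) \<longlongrightarrow> c) (at_right 0)"
proof -
  define z where "z = complex_of_real \<sigma>"
  obtain U g where U: "open U" "z \<in> U" "g meromorphic_on U"
      "\<And>s. s \<in> U \<Longrightarrow> Re s > \<sigma> \<Longrightarrow> g s = f s" "is_pole g z"
    using assms unfolding has_pole_at_abscissa_def z_def by blast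
  have "isolated_singularity_at g z"
    using U(2,3) by (intro meromorphic_on_isolated_singularity) (auto intro: meromorphic_on_subset)
  then obtain r0 where r0: "r0 > 0" "g analytic_on ball z r0 - {z}"
    unfolding isolated_singularity_at_def by blast
  define S where "S = ball z r0 \<inter> U"
  have S: "open S" "z \<in> S" "S \<subseteq> U" "g holomorphic_on S - {z}"
    using r0 U by (auto simp: S_def intro: analytic_imp_holomorphic analytic_on_subset)
  define h where "h = zor_poly g z"
  define n where "n = nat (- zorder g z)"
  obtain r where r: "zorder g z < 0" "h z \<noteq> 0" "r > 0" "cball z r \<subseteq> S" "h holomorphic_on cball z r"
      "\<And>w. w \<in> cball z r - {z} \<Longrightarrow> g w = h w / (w - z) ^ n"
    using zorder_exist_pole[OF S(4) S(1) S(2) U(5)] unfolding h_def n_def by blast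
  obtain m where m: "n = Suc m"
    using r(1) unfolding n_def by (cases "nat (- zorder g z)") auto
  have "isCont h z"
    using r(3) holomorphic_on_imp_continuous_on[OF r(5)] by (intro continuous_on_interior) auto
  then have "(h \<longlongrightarrow> h z) (at z)"
    by (simp add: isCont_def)
  moreover have "((\<lambda>\<delta>. complex_of_real (\<sigma> + \<delta>)) \<longlongrightarrow> complex_of_real (\<sigma> + 0)) (at_right 0)"
    by (intro tendsto_intros)
  ultimately have "((\<lambda>\<delta>. h (complex_of_real (\<sigma> + \<delta>))) \<longlongrightarrow> h z) (at_right 0)"
    using \<open>isCont h z\<close> by (auto simp: z_def intro: isCont_tendsto_compose)
  then have lim: "((\<lambda>\<delta>. norm (h (complex_of_real (\<sigma> + \<delta>)))) \<longlongrightarrow> norm (h z)) (at_right 0)"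
    by (rule tendsto_norm)
  have "\<forall>\<^sub>F \<delta> in at_right 0. norm (h (complex_of_real (\<sigma> + \<delta>)))
          = \<delta> ^ Suc m * norm (f (complex_of_real (\<sigma> + \<delta>)))"
    using eventually_at_right_less[of 0] eventually_at_right_real[OF r(3)]
  proof eventually_elim
    case (elim \<delta>)
    define w where "w = complex_of_real (\<sigma> + \<delta>)"
    have wz: "w - z = of_real \<delta>"
      by (simp add: w_def z_def)
    then have w: "w \<in> cball z r - {z}"
      using elim by (auto simp: dist_norm norm_minus_commute)
    have "f w = g w"
    proof -
      have "w \<in> U" "Re w > \<sigma>"
        using w r(4) S(3) elim(1) by (blast, simp add: w_def)
      then show ?thesis
        by (rule U(4)[symmetric])
    qed
    also have "\<dots> = h w / (of_real \<delta>) ^ Suc m"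
      using r(6)[OF w] wz m by simp
    finally have "norm (f w) = norm (h w) / \<delta> ^ Suc m"
      using elim by (simp add: norm_divide norm_mult norm_power)
    then show ?case
      using elim by (simp add: w_def)
  qed
  with lim have "((\<lambda>\<delta>. \<delta> ^ Suc m * norm (f (complex_of_real (\<sigma> + \<delta>)))) \<longlongrightarrow> norm (h z)) (at_right 0)"
    by (rule Lim_transform_eventually)
  moreover have "norm (h z) > 0"
    using r(2) by simp
  ultimately show ?thesis
    using that by blast
qed

section \<open>A Tauberian theorem of Karamata type\<close>

text \<open>Multiplying the Erlang density of rate \<open>1\<close> by \<open>e\<^bsup>- j t\<^esup>\<close> gives, up to a constant factor, the
  Erlang density of rate \<open>1 + j\<close>, which has mass one. These are the moments of \<open>e\<^sup>-\<^sup>t\<close>, and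
  they have exactly the form that a power law for the transform produces.\<close>

lemma integral_erlang_exp_power:
  shows "integrable (density lborel (erlang_density m 1)) (\<lambda>t. exp (-t) ^ j)"
    and "(\<integral>t. exp (-t) ^ j \<partial>density lborel (erlang_density m 1)) = 1 / (1 + real j) ^ Suc m"
proof -
  define l where "l = 1 + real j"
  have l: "l > 0"
    by (simp add: l_def)
  interpret E: prob_space "density lborel (erlang_density m l)"
    by (rule prob_space_erlang_density[OF l])
  have "has_bochner_integral (density lborel (erlang_density m l)) (\<lambda>_. 1::real) 1"
    using E.prob_space by (simp add: has_bochner_integral_iff)
  then have *: "has_bochner_integral lborel (\<lambda>t. erlang_density m l t) 1"
    using l integral_density[of "\<lambda>_. 1::real" lborel "erlang_density m l"]
      integrable_density[of "\<lambda>_. 1::real" lborel "erlang_density m l"]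
    by (simp add: has_bochner_integral_iff)
  have "erlang_density m 1 t * exp (-t) ^ j = erlang_density m l t / l ^ Suc m" for t
  proof -
    have "exp (- t) * exp (- t) ^ j = exp (- l * t)"
      by (simp add: l_def exp_of_nat_mult[symmetric] exp_add[symmetric] algebra_simps)
    then show ?thesis
      using l by (simp add: erlang_density_def mult.assoc)
  qed
  then have "has_bochner_integral lborel (\<lambda>t. erlang_density m 1 t * exp (-t) ^ j) (1 / l ^ Suc m)"
    using has_bochner_integral_divide_zero[OF *, of "l ^ Suc m"] by simp
  then show "integrable (density lborel (erlang_density m 1)) (\<lambda>t. exp (-t) ^ j)"
    and "(\<integral>t. exp (-t) ^ j \<partial>density lborel (erlang_density m 1)) = 1 / (1 + real j) ^ Suc m"
    by (auto simp: has_bochner_integral_iff integral_density integrable_density l_def)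
qed

lemma continuous_bounded_unit_interval:
  fixes h :: "real \<Rightarrow> real"
  assumes h: "continuous_on UNIV h"
  obtains B where "\<And>v. v \<in> {0..1} \<Longrightarrow> \<bar>h v\<bar> \<le> B"
proof -
  have "compact (h ` {0..1})"
    using h by (intro compact_continuous_image) (auto intro: continuous_on_subset)
  then show ?thesis
    using that by (metis bounded_real compact_imp_bounded image_eqI)
qed

text \<open>In the application \<open>N\<close> is the exponentially tilted law \<open>e\<^bsup>- \<sigma> y\<^esup> P(X \<in> dy)\<close>, where \<open>\<sigma>\<close>
  is the abscissa. It need not be a finite measure, but the tilt moves the singularity of
  the transform to \<open>0\<close>. The pole has order \<open>Suc m\<close>, so its order is at least one.\<close>

locale laplace_power_law =
  fixes N :: "real measure" and m :: nat and c :: real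
  assumes sets_N [measurable_cong]: "sets N = sets borel"
    and AE_nonneg: "AE y in N. 0 \<le> y"
    and integrable_exp: "\<And>\<delta>. \<delta> > 0 \<Longrightarrow> integrable N (\<lambda>y. exp (- \<delta> * y))"
    and power_law: "((\<lambda>\<delta>. \<delta> ^ Suc m * (\<integral>y. exp (- \<delta> * y) \<partial>N)) \<longlongrightarrow> c) (at_right 0)"
    and c_pos: "c > 0"
begin

text \<open>Substituting \<open>v = e\<^bsup>- y / x\<^esup>\<close> maps the half-line to the compact interval \<open>[0, 1]\<close>, where
  polynomials are dense among the continuous functions. The extra factor \<open>e\<^bsup>- y / x\<^esup>\<close> makes the
  integral of every bounded \<open>h\<close> finite.\<close>

definition rescaled_integral :: "(real \<Rightarrow> real) \<Rightarrow> real \<Rightarrow> real" where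
  "rescaled_integral h x = (\<integral>y. h (exp (- y / x)) * exp (- y / x) \<partial>N) / x ^ Suc m"

abbreviation erlang_integral :: "(real \<Rightarrow> real) \<Rightarrow> real" where
  "erlang_integral h \<equiv> (\<integral>t. h (exp (- t)) \<partial>density lborel (erlang_density m 1))"

lemma AE_exp_unit: "x > 0 \<Longrightarrow> AE y in N. exp (- y / x) \<in> {0..1}"
  using AE_nonneg by eventually_elim auto

lemma integrable_rescaled:
  fixes h :: "real \<Rightarrow> real"
  assumes h: "continuous_on UNIV h" and x: "x > 0"
  shows "integrable N (\<lambda>y. h (exp (- y / x)) * exp (- y / x))"
proof -
  obtain B where B: "\<And>v. v \<in> {0..1} \<Longrightarrow> \<bar>h v\<bar> \<le> B"
    using continuous_bounded_unit_interval[OF h] by blast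
  have [measurable]: "h \<in> borel_measurable borel"
    using h by (rule borel_measurable_continuous_onI)
  have "integrable N (\<lambda>y. B * exp (- (1 / x) * y))"
    using integrable_exp[of "1 / x"] x by (intro integrable_mult_right) simp
  then show ?thesis
  proof (rule Bochner_Integration.integrable_bound)
    show "AE y in N. norm (h (exp (- y / x)) * exp (- y / x)) \<le> norm (B * exp (- (1 / x) * y))"
      using AE_exp_unit[OF x]
    proof eventually_elim
      case (elim y)
      from B[OF this] show ?case
        by (auto simp: abs_mult intro!: mult_right_mono)
    qed
  qed measurable
qed

lemma AE_erlang_unit: "AE t in density lborel (erlang_density m 1). exp (- t) \<in> {0..1}"
  by (subst AE_density) (auto simp: erlang_density_def)

lemma integrable_erlang:
  fixes h :: "real \<Rightarrow> real"
  assumes h: "continuous_on UNIV h"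
  shows "integrable (density lborel (erlang_density m 1)) (\<lambda>t. h (exp (- t)))"
proof -
  interpret E: prob_space "density lborel (erlang_density m 1)"
    by (rule prob_space_erlang_density) simp
  obtain B where B: "\<And>v. v \<in> {0..1} \<Longrightarrow> \<bar>h v\<bar> \<le> B"
    using continuous_bounded_unit_interval[OF h] by blast
  have [measurable]: "h \<in> borel_measurable borel"
    using h by (rule borel_measurable_continuous_onI)
  show ?thesis
  proof (rule E.integrable_const_bound[of _ B])
    show "AE t in density lborel (erlang_density m 1). norm (h (exp (- t))) \<le> B"
      using AE_erlang_unit by eventually_elim (use B in auto)
  qed measurable
qed

text \<open>A monomial turns the rescaled integral into the transform at \<open>(1 + j) / x\<close>, so that the
  power law applies directly.\<close>

lemma rescaled_integral_power:
  "((\<lambda>x. rescaled_integral (\<lambda>v. v ^ j) x) \<longlongrightarrow> c * erlang_integral (\<lambda>v. v ^ j)) at_top"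
proof -
  define l where "l = 1 + real j"
  have l: "l > 0"
    by (simp add: l_def)
  have "filterlim (\<lambda>x. l / x) (at_right 0) at_top"
    using l by real_asymp
  from filterlim_compose[OF power_law this]
  have "((\<lambda>x. (l / x) ^ Suc m * (\<integral>y. exp (- (l / x) * y) \<partial>N) / l ^ Suc m) \<longlongrightarrow> c / l ^ Suc m) at_top"
    using l by (intro tendsto_divide) auto
  moreover have "(l / x) ^ Suc m * (\<integral>y. exp (- (l / x) * y) \<partial>N) / l ^ Suc m
      = rescaled_integral (\<lambda>v. v ^ j) x" for x
  proof -
    have "exp (- y / x) ^ j * exp (- y / x) = exp (- (l / x) * y)" for y
      by (simp add: l_def exp_of_nat_mult[symmetric] exp_add[symmetric] add_divide_distrib algebra_simps)
    then show ?thesis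
      using l by (simp add: rescaled_integral_def power_divide)
  qed
  ultimately show ?thesis
    using integral_erlang_exp_power(2)[of m j] by (simp add: l_def)
qed

lemma rescaled_integral_polynomial:
  "((\<lambda>x. rescaled_integral (\<lambda>v. \<Sum>i\<le>n. a i * v ^ i) x)
      \<longlongrightarrow> c * erlang_integral (\<lambda>v. \<Sum>i\<le>n. a i * v ^ i)) at_top"
proof -
  have "erlang_integral (\<lambda>v. \<Sum>i\<le>n. a i * v ^ i) = (\<Sum>i\<le>n. a i * erlang_integral (\<lambda>v. v ^ i))"
    using integral_erlang_exp_power(1)[of m] by simp
  then have eq: "c * erlang_integral (\<lambda>v. \<Sum>i\<le>n. a i * v ^ i)
      = (\<Sum>i\<le>n. a i * (c * erlang_integral (\<lambda>v. v ^ i)))"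
    by (simp add: sum_distrib_left mult_ac)
  have "((\<lambda>x. \<Sum>i\<le>n. a i * rescaled_integral (\<lambda>v. v ^ i) x)
      \<longlongrightarrow> c * erlang_integral (\<lambda>v. \<Sum>i\<le>n. a i * v ^ i)) at_top"
    unfolding eq by (intro tendsto_intros rescaled_integral_power)
  moreover have "\<forall>\<^sub>F x in at_top. (\<Sum>i\<le>n. a i * rescaled_integral (\<lambda>v. v ^ i) x)
      = rescaled_integral (\<lambda>v. \<Sum>i\<le>n. a i * v ^ i) x"
    using eventually_gt_at_top[of 0]
  proof eventually_elim
    case (elim x)
    have "integrable N (\<lambda>y. exp (- y / x) ^ i * exp (- y / x))" for i
      using elim by (intro integrable_rescaled continuous_intros)
    then show ?case
      by (simp add: rescaled_integral_def sum_distrib_right mult.assoc sum_divide_distrib)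
  qed
  ultimately show ?thesis
    by (rule Lim_transform_eventually)
qed

lemma rescaled_integral_close:
  assumes h: "continuous_on UNIV h" and g: "continuous_on UNIV g" and x: "x > 0"
    and close: "\<And>v. v \<in> {0..1} \<Longrightarrow> \<bar>h v - g v\<bar> \<le> e"
  shows "\<bar>rescaled_integral h x - rescaled_integral g x\<bar> \<le> e * rescaled_integral (\<lambda>_. 1) x"
proof -
  have i1: "integrable N (\<lambda>y. e * exp (- y / x))"
    using integrable_rescaled[of "\<lambda>_. e", OF _ x] by simp
  let ?I = "\<lambda>f. \<integral>y. f (exp (- y / x)) * exp (- y / x) \<partial>N"
  note ih = integrable_rescaled[OF h x] and ig = integrable_rescaled[OF g x]
  have "\<bar>?I h - ?I g\<bar> = \<bar>\<integral>y. h (exp (- y / x)) * exp (- y / x) - g (exp (- y / x)) * exp (- y / x) \<partial>N\<bar>"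
    using ih ig by simp
  also have "\<dots> \<le> (\<integral>y. \<bar>h (exp (- y / x)) * exp (- y / x) - g (exp (- y / x)) * exp (- y / x)\<bar> \<partial>N)"
    by (rule integral_abs_bound)
  also have "\<dots> \<le> (\<integral>y. e * exp (- y / x) \<partial>N)"
  proof (rule integral_mono_AE)
    show "AE y in N. \<bar>h (exp (- y / x)) * exp (- y / x) - g (exp (- y / x)) * exp (- y / x)\<bar>
        \<le> e * exp (- y / x)"
      using AE_exp_unit[OF x]
    proof eventually_elim
      case (elim y)
      have "h (exp (- y / x)) * exp (- y / x) - g (exp (- y / x)) * exp (- y / x)
          = (h (exp (- y / x)) - g (exp (- y / x))) * exp (- y / x)"
        by (simp add: left_diff_distrib)
      with close[OF elim] show ?case
        by (simp add: abs_mult)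
    qed
  qed (use ih ig i1 in \<open>auto simp del: integrable_mult_right_iff\<close>)
  finally have "\<bar>?I h - ?I g\<bar> \<le> e * ?I (\<lambda>_. 1)"
    by simp
  then have "\<bar>?I h - ?I g\<bar> / x ^ Suc m \<le> e * ?I (\<lambda>_. 1) / x ^ Suc m"
    using x by (intro divide_right_mono) auto
  then show ?thesis
    using x by (simp add: rescaled_integral_def diff_divide_distrib[symmetric] abs_mult)
qed

lemma erlang_integral_close:
  assumes h: "continuous_on UNIV h" and g: "continuous_on UNIV g"
    and close: "\<And>v. v \<in> {0..1} \<Longrightarrow> \<bar>h v - g v\<bar> \<le> e"
  shows "\<bar>erlang_integral h - erlang_integral g\<bar> \<le> e"
proof -
  interpret E: prob_space "density lborel (erlang_density m 1)"
    by (rule prob_space_erlang_density) simp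
  note ih = integrable_erlang[OF h] and ig = integrable_erlang[OF g]
  have "\<bar>erlang_integral h - erlang_integral g\<bar> = \<bar>erlang_integral (\<lambda>v. h v - g v)\<bar>"
    using ih ig by simp
  also have "\<dots> \<le> erlang_integral (\<lambda>v. \<bar>h v - g v\<bar>)"
    by (rule integral_abs_bound)
  also have "\<dots> \<le> (\<integral>t. e \<partial>density lborel (erlang_density m 1))"
    by (rule integral_mono_AE) (use ih ig AE_erlang_unit close in \<open>auto elim!: eventually_mono\<close>)
  finally show ?thesis
    using E.prob_space by simp
qed

text \<open>Convergence passes from polynomials to continuous functions because the rescaled
  integral of the constant \<open>1\<close> stays bounded: a uniform error in the test function
  produces a proportional error in the integral, for all large \<open>x\<close> at once.\<close>

theorem rescaled_integral_tendsto:
  assumes h: "continuous_on UNIV h"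
  shows "(rescaled_integral h \<longlongrightarrow> c * erlang_integral h) at_top"
proof (rule tendstoI)
  fix \<epsilon> :: real
  assume \<epsilon>: "\<epsilon> > 0"
  \<comment> \<open>Replacing \<open>h\<close> by \<open>g\<close> costs \<open>e (c + 1)\<close> before and \<open>c e\<close> after the limit; the limit for \<open>g\<close> costs \<open>e\<close>.\<close>
  define e where "e = \<epsilon> / (2 * c + 2)"
  have e: "e > 0" "e * (2 * c + 2) = \<epsilon>"
    using \<epsilon> c_pos by (auto simp: e_def)
  obtain g where "real_polynomial_function g" and close: "\<And>v. v \<in> {0..1} \<Longrightarrow> \<bar>h v - g v\<bar> < e"
    using Stone_Weierstrass_real_polynomial_function[of "{0..1}" h e] h e(1)
    by (metis compact_Icc continuous_on_subset subset_UNIV)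
  then obtain a n where g_eq: "g = (\<lambda>v. \<Sum>i\<le>n. a i * v ^ i)"
    using real_polynomial_function_iff_sum by blast
  have g: "continuous_on UNIV g"
    unfolding g_eq by (intro continuous_intros)
  have "(rescaled_integral g \<longlongrightarrow> c * erlang_integral g) at_top"
    using rescaled_integral_polynomial[of a n] unfolding g_eq .
  then have ev1: "\<forall>\<^sub>F x in at_top. dist (rescaled_integral g x) (c * erlang_integral g) < e"
    using e(1) by (rule tendstoD)
  have "c * erlang_integral (\<lambda>_. 1) = c"
    using integral_erlang_exp_power(2)[of m 0] by simp
  then have ev2: "\<forall>\<^sub>F x in at_top. rescaled_integral (\<lambda>_. 1) x < c + 1"
    using rescaled_integral_power[of 0] by (auto intro: order_tendstoD)
  have "\<bar>erlang_integral h - erlang_integral g\<bar> \<le> e"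
    by (intro erlang_integral_close h g less_imp_le close)
  then have limits: "\<bar>c * erlang_integral h - c * erlang_integral g\<bar> \<le> c * e"
    using c_pos by (simp add: abs_mult flip: right_diff_distrib)
  show "\<forall>\<^sub>F x in at_top. dist (rescaled_integral h x) (c * erlang_integral h) < \<epsilon>"
    using ev1 ev2 eventually_gt_at_top[of 0]
  proof eventually_elim
    case (elim x)
    have "\<bar>rescaled_integral h x - rescaled_integral g x\<bar> \<le> e * rescaled_integral (\<lambda>_. 1) x"
      by (intro rescaled_integral_close h g elim less_imp_le close)
    also have "\<dots> \<le> e * (c + 1)"
      using elim e by (intro mult_left_mono) auto
    finally have "\<bar>rescaled_integral h x - c * erlang_integral h\<bar> < e * (c + 1) + e + c * e"
      using elim limits by (simp add: dist_real_def)
    also have "\<dots> = \<epsilon>"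
      using e(2) by (simp add: algebra_simps)
    finally show ?case
      by (simp add: dist_real_def)
  qed
qed

text \<open>Test the weak limit against a continuous bump that vanishes outside \<open>(1, K)\<close> in the
  variable \<open>t = y / x\<close>. The indicator of the interval dominates the bump, while the bump has a
  positive integral in the limit. Finiteness of the mass is recorded because \<open>measure\<close> is \<open>0\<close>
  on sets of infinite measure.\<close>

corollary measure_Ioc_lower_bound:
  assumes K: "K > 1"
  obtains d where "d > 0"
    "\<forall>\<^sub>F x in at_top. emeasure N {x<..K * x} < \<infinity> \<and> d * x ^ Suc m \<le> measure N {x<..K * x}"
proof -
  define h :: "real \<Rightarrow> real" where "h v = max 0 ((v - exp (- K)) * (exp (- 1) - v))" for v
  have h: "continuous_on UNIV h"
    unfolding h_def by (intro continuous_intros)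
  have h0: "h v \<ge> 0" for v
    by (simp add: h_def)
  have hpos: "h (exp (- t)) > 0" if "1 < t" "t < K" for t
    using that by (auto simp: h_def less_max_iff_disj)
  have hzero: "h (exp (- t)) = 0" if "\<not> (1 < t \<and> t \<le> K)" for t
  proof -
    have "(exp (- t) - exp (- K)) * (exp (- 1) - exp (- t)) \<le> 0"
      using that K by (auto simp: mult_le_0_iff)
    then show ?thesis
      by (simp add: h_def)
  qed
  have h1: "h v \<le> 1" if "v \<in> {0..1}" for v
  proof -
    have "\<bar>v - exp (- s)\<bar> \<le> 1" if "s > 0" for s
    proof -
      have "exp (- s) \<in> {0..1}"
        using that by simp
      with \<open>v \<in> {0..1}\<close> show ?thesis
        unfolding atLeastAtMost_iff by linarith
    qed
    from this[of K] this[of 1] K have "\<bar>v - exp (- K)\<bar> * \<bar>exp (- 1) - v\<bar> \<le> 1 * 1"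
      by (intro mult_mono) (auto simp: abs_minus_commute)
    then show ?thesis
      by (simp add: h_def abs_le_iff flip: abs_mult)
  qed
  have pos: "erlang_integral h > 0"
  proof -
    have "erlang_integral h \<noteq> 0"
    proof
      assume "erlang_integral h = 0"
      then have "AE t in density lborel (erlang_density m 1). h (exp (- t)) = 0"
        using integrable_erlang[OF h] h0 by (subst (asm) integral_nonneg_eq_0_iff_AE) auto
      then have "AE t in lborel. erlang_density m 1 t > 0 \<longrightarrow> h (exp (- t)) = 0"
        by (subst (asm) AE_density) auto
      then have "AE t in lborel. t \<notin> {1<..<K}"
        by eventually_elim (use hpos in \<open>force simp: erlang_density_def\<close>)
      then have "emeasure lborel {1<..<K} = 0"
        by (subst (asm) AE_iff_measurable[OF _ refl]) (auto simp: greaterThanLessThan_def greaterThan_def lessThan_def Collect_conj_eq)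
      then show False
        using K by simp
    qed
    moreover have "erlang_integral h \<ge> 0"
      using h0 by simp
    ultimately show ?thesis
      by simp
  qed
  define d where "d = c * erlang_integral h / 2"
  have d: "0 < d" "d < c * erlang_integral h"
    using pos c_pos by (auto simp: d_def)
  have "\<forall>\<^sub>F x in at_top. emeasure N {x<..K * x} < \<infinity> \<and> d * x ^ Suc m \<le> measure N {x<..K * x}"
    using order_tendstoD(1)[OF rescaled_integral_tendsto[OF h] d(2)] eventually_gt_at_top[of 0]
  proof eventually_elim
    case (elim x)
    have int: "integrable N (\<lambda>y. exp (- (1 / x) * y))"
      using elim by (intro integrable_exp) simp
    have "emeasure N {x<..K * x} = (\<integral>\<^sup>+y. indicator {x<..K * x} y \<partial>N)"
      by (simp add: sets_N)
    also have "\<dots> \<le> (\<integral>\<^sup>+y. ennreal (exp K) * ennreal (exp (- (1 / x) * y)) \<partial>N)"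
    proof (rule nn_integral_mono)
      fix y
      have "1 \<le> exp K * exp (- (1 / x) * y)" if "y \<le> K * x"
        using that elim by (simp add: exp_add[symmetric] field_simps)
      then show "indicator {x<..K * x} y \<le> ennreal (exp K) * ennreal (exp (- (1 / x) * y))"
        by (auto simp: indicator_def simp flip: ennreal_mult')
    qed
    also have "\<dots> = ennreal (exp K) * (\<integral>\<^sup>+y. ennreal (exp (- (1 / x) * y)) \<partial>N)"
      by (rule nn_integral_cmult) simp
    also have "\<dots> < \<infinity>"
      using int by (subst nn_integral_eq_integral) (auto simp: ennreal_mult_less_top)
    finally have fin: "emeasure N {x<..K * x} < \<infinity>" .
    have "d * x ^ Suc m \<le> rescaled_integral h x * x ^ Suc m"
      using elim by (intro mult_right_mono) auto
    also have "\<dots> = (\<integral>y. h (exp (- y / x)) * exp (- y / x) \<partial>N)"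
      using elim by (simp add: rescaled_integral_def)
    also have "\<dots> \<le> (\<integral>y. indicator {x<..K * x} y \<partial>N)"
    proof (rule integral_mono_AE)
      show "integrable N (\<lambda>y. h (exp (- y / x)) * exp (- y / x))"
        using elim by (intro integrable_rescaled h) simp
      show "integrable N (indicator {x<..K * x} :: real \<Rightarrow> real)"
        using fin by (simp add: sets_N)
      show "AE y in N. h (exp (- y / x)) * exp (- y / x) \<le> indicator {x<..K * x} y"
        using AE_exp_unit[OF elim(2)]
      proof eventually_elim
        case (elim y)
        show ?case
        proof (cases "1 < y / x \<and> y / x \<le> K")
          case True
          then have "y \<in> {x<..K * x}"
            using \<open>0 < x\<close> by (auto simp: field_simps)
          moreover have "h (exp (- y / x)) * exp (- y / x) \<le> 1 * 1"
            using h1[OF elim] elim h0 by (intro mult_mono) auto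
          ultimately show ?thesis
            by simp
        next
          case False
          then show ?thesis
            using hzero[of "y / x"] by simp
        qed
      qed
    qed
    also have "\<dots> = measure N {x<..K * x}"
      by (simp add: sets_N)
    finally show ?case
      using fin by blast
  qed
  with d(1) that show ?thesis
    by blast
qed

end

section \<open>The transform at real points\<close>

text \<open>At real points the integrand is nonnegative, so the integrals over \<open>[0, R]\<close> increase with \<open>R\<close>,
  and monotone convergence upgrades convergence of the improper integral to integrability.\<close>

lemma laplace_stieltjes_cdf_of_real:
  assumes "real_distribution D" and nonneg: "AE x in D. 0 \<le> x"
    and conv: "ls_converges (cdf D) (complex_of_real u)"
  shows "integrable D (\<lambda>x. exp (- u * x))"
    and "laplace_stieltjes (cdf D) (complex_of_real u) = complex_of_real (\<integral>x. exp (- u * x) \<partial>D)"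
proof -
  interpret D: real_distribution D by fact
  \<comment> \<open>A law on the line is determined by its distribution function.\<close>
  have "real_distribution (interval_measure (cdf D))" "cdf (interval_measure (cdf D)) = cdf D"
    by (auto intro!: real_distribution_interval_measure cdf_interval_measure D.cdf_nondecreasing
        D.cdf_is_right_cont D.cdf_lim_at_bot D.cdf_lim_at_top_prob)
  then have D_eq: "interval_measure (cdf D) = D"
    by (intro cdf_unique) (auto simp: assms(1))
  define r where "r n = (\<integral>x. indicator {0..real n} x * exp (- u * x) \<partial>D)" for n :: nat
  have partial: "ls_partial (cdf D) (complex_of_real u) (real n) = complex_of_real (r n)" for n
  proof -
    have "indicator {0..real n} x *\<^sub>R exp (- complex_of_real u * complex_of_real x)
        = complex_of_real (indicator {0..real n} x * exp (- u * x))" for x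
      by (simp add: scaleR_conv_of_real exp_of_real flip: of_real_mult of_real_minus)
    then show ?thesis
      unfolding ls_partial_def D_eq r_def set_lebesgue_integral_def
      by (simp only: integral_complex_of_real)
  qed
  obtain l where l: "(ls_partial (cdf D) (complex_of_real u) \<longlongrightarrow> l) at_top"
    using conv by (auto simp: ls_converges_def)
  have lim: "(\<lambda>n. complex_of_real (r n)) \<longlonglongrightarrow> l"
    using filterlim_compose[OF l filterlim_real_sequentially] by (simp add: partial)
  then have r_lim: "r \<longlonglongrightarrow> Re l"
    using tendsto_Re[OF lim] by simp
  have l_real: "l = complex_of_real (Re l)"
    using LIMSEQ_unique[OF lim tendsto_of_real[OF r_lim]] .
  have int: "integrable D (\<lambda>x. indicator {0..real n} x * exp (- u * x))" for n
  proof (rule D.integrable_const_bound[of _ "exp (\<bar>u\<bar> * real n)"])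
    have "- (u * x) \<le> \<bar>u\<bar> * real n" if "0 \<le> x" "x \<le> real n" for x
    proof -
      have "- (u * x) \<le> \<bar>u * x\<bar>"
        by simp
      also have "\<dots> \<le> \<bar>u\<bar> * real n"
        using that by (simp add: abs_mult mult_left_mono)
      finally show ?thesis .
    qed
    then show "AE x in D. norm (indicator {0..real n} x * exp (- u * x)) \<le> exp (\<bar>u\<bar> * real n)"
      by (intro AE_I2) (auto simp: indicator_def)
  qed simp
  have *: "integrable D (\<lambda>x. exp (- u * x)) \<and> (\<integral>x. exp (- u * x) \<partial>D) = Re l"
  proof (intro conjI)
    have mono: "AE x in D. mono (\<lambda>n. indicator {0..real n} x * exp (- u * x))"
      by (intro AE_I2) (auto simp: mono_def indicator_def)
    have pointwise: "AE x in D. (\<lambda>n. indicator {0..real n} x * exp (- u * x)) \<longlonglongrightarrow> exp (- u * x)"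
      using nonneg
    proof eventually_elim
      case (elim x)
      have "\<forall>\<^sub>F n in sequentially. x \<le> real n"
        using filterlim_real_sequentially by (auto simp: filterlim_at_top)
      then have "\<forall>\<^sub>F n in sequentially. indicator {0..real n} x * exp (- u * x) = exp (- u * x)"
        by eventually_elim (use elim in auto)
      then show ?case
        by (rule tendsto_eventually)
    qed
    show "integrable D (\<lambda>x. exp (- u * x))"
      by (rule integrable_monotone_convergence[OF int mono pointwise r_lim[unfolded r_def]]) simp
    show "(\<integral>x. exp (- u * x) \<partial>D) = Re l"
      by (rule integral_monotone_convergence[OF int mono pointwise r_lim[unfolded r_def]]) simp
  qed
  then show "integrable D (\<lambda>x. exp (- u * x))"
    by blast
  have "laplace_stieltjes (cdf D) (complex_of_real u) = l"
    unfolding laplace_stieltjes_def using l by (intro tendsto_Lim) auto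
  with * l_real
  show "laplace_stieltjes (cdf D) (complex_of_real u) = complex_of_real (\<integral>x. exp (- u * x) \<partial>D)"
    by simp
qed

section \<open>The decay rate of the tail\<close>

text \<open>Markov's inequality gives \<open>P(X > x) \<le> C e\<^bsup>u x\<^esup>\<close> for each \<open>u\<close> strictly between \<open>\<sigma>\<close> and \<open>0\<close>;
  the constant \<open>C\<close> disappears after taking logarithms and dividing by \<open>x\<close>. Positivity of the
  tail keeps the logarithm away from the conventional value \<open>ln 0 = 0\<close>.\<close>

lemma tail_upper_bound:
  fixes \<sigma> :: real
  assumes "real_distribution D" and "\<sigma> < 0"
    and int: "\<And>u. u > \<sigma> \<Longrightarrow> integrable D (\<lambda>x. exp (- u * x))"
    and pos: "\<And>x. measure D {x<..} > 0" and e: "e > 0"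
  shows "\<forall>\<^sub>F x in at_top. 1 / x * ln (measure D {x<..}) < \<sigma> + e"
proof -
  interpret D: real_distribution D by fact
  define u where "u = \<sigma> + min (e / 2) (- \<sigma> / 2)"
  have u: "\<sigma> < u" "u \<le> \<sigma> + e / 2" "u < 0"
    using e \<open>\<sigma> < 0\<close> by (auto simp: u_def min_def)
  define C where "C = (\<integral>x. exp (- u * x) \<partial>D)"
  have chernoff: "measure D {x<..} \<le> exp (u * x) * C" for x
  proof -
    have "measure D {x<..} = (\<integral>y. indicator {x<..} y \<partial>D)"
      by simp
    also have "\<dots> \<le> (\<integral>y. exp (u * x) * exp (- u * y) \<partial>D)"
    proof (rule integral_mono)
      show "integrable D (indicator {x<..} :: real \<Rightarrow> real)"
        by (simp add: D.emeasure_eq_measure)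
      show "integrable D (\<lambda>y. exp (u * x) * exp (- u * y))"
        using int[OF u(1)] by simp
      show "indicator {x<..} y \<le> exp (u * x) * exp (- u * y)" for y
        using u(3) by (auto simp: indicator_def exp_add[symmetric])
    qed
    finally show ?thesis
      by (simp add: C_def)
  qed
  have C: "C > 0"
    using pos[of 0] chernoff[of 0] by simp
  have "((\<lambda>x. ln C / x) \<longlongrightarrow> 0) at_top"
    by real_asymp
  then have "\<forall>\<^sub>F x in at_top. ln C / x < e / 2"
    using e by (intro order_tendstoD) auto
  then show ?thesis
    using eventually_gt_at_top[of 0]
  proof eventually_elim
    case (elim x)
    have "ln (measure D {x<..}) \<le> ln (exp (u * x) * C)"
      using pos C chernoff by (intro ln_mono) auto
    also have "\<dots> = u * x + ln C"
      using C by (simp add: ln_mult)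
    finally have "1 / x * ln (measure D {x<..}) \<le> u + ln C / x"
      using elim by (simp add: field_simps)
    then show ?case
      using elim u(2) by linarith
  qed
qed

text \<open>All the mass that the tilted measure has in \<open>(x, K x]\<close> comes from the tail beyond \<open>x\<close>,
  enlarged by a factor of at most \<open>e\<^bsup>- \<sigma> K x\<^esup>\<close>. Hence a lower bound for that mass is a lower
  bound for the tail, with a loss in the exponent that vanishes as \<open>K\<close> approaches \<open>1\<close>.\<close>

lemma tail_lower_bound:
  fixes \<sigma> :: real
  assumes "real_distribution D" and "\<sigma> < 0" and nonneg: "AE x in D. 0 \<le> x"
    and int: "\<And>u. u > \<sigma> \<Longrightarrow> integrable D (\<lambda>x. exp (- u * x))"
    and power: "((\<lambda>\<delta>. \<delta> ^ Suc m * (\<integral>x. exp (- (\<sigma> + \<delta>) * x) \<partial>D)) \<longlongrightarrow> c) (at_right 0)"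
    and c: "c > 0" and e: "e > 0"
  shows "\<forall>\<^sub>F x in at_top. measure D {x<..} > 0 \<and> 1 / x * ln (measure D {x<..}) > \<sigma> - e"
proof -
  interpret D: real_distribution D by fact
  define N where "N = density D (\<lambda>x. ennreal (exp (- \<sigma> * x)))"
  have tilt: "exp (- \<sigma> * x) * exp (- \<delta> * x) = exp (- (\<sigma> + \<delta>) * x)" for x \<delta>
    by (simp add: exp_add[symmetric] algebra_simps)
  interpret N: laplace_power_law N m c
  proof
    show "sets N = sets borel"
      by (simp add: N_def)
    show "AE y in N. 0 \<le> y"
      unfolding N_def using nonneg by (subst AE_density) (auto elim: eventually_mono)
    show "integrable N (\<lambda>y. exp (- \<delta> * y))" if "\<delta> > 0" for \<delta>
      using int[of "\<sigma> + \<delta>"] that unfolding N_def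
      by (subst integrable_density) (simp_all add: tilt[simplified])
    have "(\<integral>y. exp (- \<delta> * y) \<partial>N) = (\<integral>x. exp (- (\<sigma> + \<delta>) * x) \<partial>D)" for \<delta>
      unfolding N_def by (subst integral_density) (simp_all add: tilt[simplified])
    with power show "((\<lambda>\<delta>. \<delta> ^ Suc m * (\<integral>y. exp (- \<delta> * y) \<partial>N)) \<longlongrightarrow> c) (at_right 0)"
      by presburger
  qed (rule c)
  \<comment> \<open>The loss \<open>- \<sigma> (K - 1)\<close> in the exponent is half of the allowed error.\<close>
  define K where "K = 1 + e / (2 * (- \<sigma>))"
  have K: "K > 1" "\<sigma> * K = \<sigma> - e / 2"
    using e \<open>\<sigma> < 0\<close> by (auto simp: K_def field_simps)
  obtain d where d: "d > 0" and ev: "\<forall>\<^sub>F x in at_top. emeasure N {x<..K * x} < \<infinity> \<and>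
      d * x ^ Suc m \<le> measure N {x<..K * x}"
    using N.measure_Ioc_lower_bound[OF K(1)] by blast
  have "((\<lambda>x. ln d / x) \<longlongrightarrow> 0) at_top"
    by real_asymp
  then have "\<forall>\<^sub>F x in at_top. ln d / x > - (e / 2)"
    using e by (intro order_tendstoD) auto
  with ev show ?thesis
    using eventually_ge_at_top[of 1]
  proof eventually_elim
    case (elim x)
    have "ennreal d \<le> ennreal (measure N {x<..K * x})"
    proof (rule ennreal_leI)
      have "d * 1 \<le> d * x ^ Suc m"
        using d elim by (intro mult_left_mono one_le_power) auto
      with elim show "d \<le> measure N {x<..K * x}"
        by simp
    qed
    also have "\<dots> = emeasure N {x<..K * x}"
      using elim by (intro emeasure_eq_ennreal_measure[symmetric]) auto
    also have "\<dots> = (\<integral>\<^sup>+y. ennreal (exp (- \<sigma> * y)) * indicator {x<..K * x} y \<partial>D)"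
      unfolding N_def by (rule emeasure_density) auto
    also have "\<dots> \<le> (\<integral>\<^sup>+y. ennreal (exp (- \<sigma> * (K * x))) * indicator {x<..} y \<partial>D)"
      using \<open>\<sigma> < 0\<close>
      by (intro nn_integral_mono) (auto simp: indicator_def intro!: ennreal_leI mult_left_mono_neg)
    also have "\<dots> = ennreal (exp (- \<sigma> * (K * x)) * measure D {x<..})"
      by (subst nn_integral_cmult_indicator) (simp_all add: D.emeasure_eq_measure ennreal_mult')
    finally have le: "d \<le> exp (- (\<sigma> * K) * x) * measure D {x<..}"
      by (simp add: ennreal_le_iff mult_ac)
    then have pos: "measure D {x<..} > 0"
      using d by (metis less_le_trans exp_gt_zero zero_less_mult_pos)
    have "ln d \<le> ln (exp (- (\<sigma> * K) * x) * measure D {x<..})"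
      using le d by (intro ln_mono) auto
    also have "\<dots> = - (\<sigma> * K) * x + ln (measure D {x<..})"
      using pos by (simp add: ln_mult)
    finally have "(\<sigma> * K * x + ln d) / x \<le> ln (measure D {x<..}) / x"
      using elim by (intro divide_right_mono) auto
    then have "\<sigma> * K + ln d / x \<le> 1 / x * ln (measure D {x<..})"
      using elim by (simp add: add_divide_distrib)
    then show ?case
      using pos elim K(2) by linarith
  qed
qed

theorem theorem3:
  fixes M :: "'a measure" and X :: "'a \<Rightarrow> real"
    and F :: "real \<Rightarrow> real" and \<phi> :: "complex \<Rightarrow> complex" and \<sigma>\<^sub>0 :: real
  assumes "prob_space M"
    and "X \<in> borel_measurable M"
    and "\<And>\<omega>. \<omega> \<in> space M \<Longrightarrow> 0 \<le> X \<omega>"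
    and "F = (\<lambda>x. \<P>(\<omega> in M. X \<omega> \<le> x))"
    and "\<phi> = laplace_stieltjes F"
    and "is_abscissa_of_convergence F \<sigma>\<^sub>0"
    and "\<sigma>\<^sub>0 < 0"
    and "has_pole_at_abscissa \<phi> \<sigma>\<^sub>0"
  shows "((\<lambda>x::real. 1 / x * ln (\<P>(\<omega> in M. X \<omega> > x))) \<longlongrightarrow> \<sigma>\<^sub>0) at_top"
proof -
  interpret prob_space M by fact
  note [measurable] = assms(2)
  define D where "D = distr M borel X"
  have D: "real_distribution D"
    unfolding D_def by (rule real_distribution_distr) (rule assms(2))
  interpret D: real_distribution D by (rule D)
  have nonneg: "AE x in D. 0 \<le> x"
    unfolding D_def using assms(3) by (subst AE_distr_iff) auto
  have F: "F = cdf D"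
    unfolding assms(4) cdf_def D_def
    by (auto simp: fun_eq_iff measure_distr intro!: arg_cong[where f = prob])
  have tail: "\<P>(\<omega> in M. X \<omega> > x) = measure D {x<..}" for x
    unfolding D_def by (subst measure_distr) (auto intro!: arg_cong[where f = prob])
  have conv: "ls_converges (cdf D) (complex_of_real u)" if "u > \<sigma>\<^sub>0" for u
    using assms(6) that by (simp add: is_abscissa_of_convergence_def F)
  note transform = laplace_stieltjes_cdf_of_real[OF D nonneg conv]
  obtain m c where c: "c > 0"
    and lim: "((\<lambda>\<delta>. \<delta> ^ Suc m * norm (\<phi> (complex_of_real (\<sigma>\<^sub>0 + \<delta>)))) \<longlongrightarrow> c) (at_right 0)"
    using pole_at_abscissa_power_law[OF assms(8)] by blast
  have "\<forall>\<^sub>F \<delta> in at_right 0. \<delta> ^ Suc m * norm (\<phi> (complex_of_real (\<sigma>\<^sub>0 + \<delta>)))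
      = \<delta> ^ Suc m * (\<integral>x. exp (- (\<sigma>\<^sub>0 + \<delta>) * x) \<partial>D)"
    using eventually_at_right_less[of 0]
  proof eventually_elim
    case (elim \<delta>)
    have "norm (\<phi> (complex_of_real (\<sigma>\<^sub>0 + \<delta>))) = \<bar>\<integral>x. exp (- (\<sigma>\<^sub>0 + \<delta>) * x) \<partial>D\<bar>"
      using transform(2)[of "\<sigma>\<^sub>0 + \<delta>"] elim unfolding assms(5) F by (simp only: norm_of_real)
    also have "\<dots> = (\<integral>x. exp (- (\<sigma>\<^sub>0 + \<delta>) * x) \<partial>D)"
      by (intro abs_of_nonneg integral_nonneg_AE AE_I2) simp
    finally show ?case
      by (rule arg_cong)
  qed
  with lim have power: "((\<lambda>\<delta>. \<delta> ^ Suc m * (\<integral>x. exp (- (\<sigma>\<^sub>0 + \<delta>) * x) \<partial>D)) \<longlongrightarrow> c) (at_right 0)"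
    by (rule Lim_transform_eventually)
  have int: "integrable D (\<lambda>x. exp (- u * x))" if "u > \<sigma>\<^sub>0" for u
    using transform(1) that .
  have lower: "\<forall>\<^sub>F x in at_top. measure D {x<..} > 0 \<and> 1 / x * ln (measure D {x<..}) > \<sigma>\<^sub>0 - e"
    if "e > 0" for e
    using tail_lower_bound[OF D assms(7) nonneg int power c that] .
  \<comment> \<open>The tail decreases, so positivity far out gives positivity everywhere.\<close>
  have pos: "measure D {x<..} > 0" for x
  proof -
    have "\<forall>\<^sub>F y in at_top. measure D {y<..} > 0 \<and> x \<le> y"
      using lower[OF zero_less_one] eventually_ge_at_top[of x] by eventually_elim auto
    then obtain y where "measure D {y<..} > 0" "x \<le> y"
      by (auto dest: eventually_happens)
    moreover from this have "measure D {y<..} \<le> measure D {x<..}"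
      by (intro D.finite_measure_mono) auto
    ultimately show ?thesis
      by linarith
  qed
  have "((\<lambda>x. 1 / x * ln (measure D {x<..})) \<longlongrightarrow> \<sigma>\<^sub>0) at_top"
  proof (rule tendstoI)
    fix e :: real
    assume e: "e > 0"
    have upper: "\<forall>\<^sub>F x in at_top. 1 / x * ln (measure D {x<..}) < \<sigma>\<^sub>0 + e"
      using tail_upper_bound[OF D assms(7) int pos e] .
    show "\<forall>\<^sub>F x in at_top. dist (1 / x * ln (measure D {x<..})) \<sigma>\<^sub>0 < e"
      using lower[OF e] upper
      by eventually_elim (auto simp: dist_real_def abs_less_iff)
  qed
  then show ?thesis
    by (simp only: tail)
qed

end
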